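(* Let $p\in[0,1]$ and let $\Gamma_{2,3}$ be the percolation Markov decision process on $\mathbb{Z}$ with i.i.d. $\mathrm{Bernoulli}(p)$ payoffs on the vertices and action set $\{2,3\}$. The 4-myopic strategy $$\sigma^*(a01b)=+3,\quad \sigma^*(a10b)=+2,\quad \sigma^*(abb0)=+3,\quad \sigma^*(abb1)=+2$$ (for all $a,b\in\{0,1\}$) is optimal for any $p$, and the limit value is $$v_\infty(p)=\frac{p(3-3p+p^3)}{1+p-3p^2+2p^3}.$$
   Context: Percolation Markov decision process on $\mathbb{Z}$ with payoffs on the vertices: $I\subset\mathbb{Z}$ is a non-empty finite action set, and $(g_\omega(z))_{z\in\mathbb{Z}}$ are i.i.d. real random variables (here $\mathrm{Bernoulli}(p)$) on a probability space $(\Omega,\mathscr{F},\mathbb{P})$; taking action $i$ at state $z$ gives payoff $g_\omega(z+i)$ and moves the state to $z+i$. The realization $\omega$ of all payoffs is known in advance to the decision maker. A strategy is a sequence $\sigma=(\sigma_m)_{m\ge1}$ of maps $\sigma_m:\Omega\times\mathbb{Z}\to I$ measurable with respect to the product of the $\sigma$-algebra generated by the payoffs and $\mathcal{P}(\mathbb{Z})$; given initial state $z$, it induces $z_1=z$, $i_m=\sigma_m(\omega,z)$, $z_{m+1}=z_m+i_m$. The $n$-stage payoff is $\gamma_n(z,\sigma)=\frac1n\sum_{m=1}^n g_\omega(z_m+i_m)$, the $n$-stage value is $v_n(z)=\max_\sigma\gamma_n(z,\sigma)$, and the limit value $v_\infty(p)$ is the $\mathbb{P}$-almost sure limit of $v_n(z)$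 as $n\to\infty$ (a constant independent of $z$). A strategy is stationary if the action at each stage depends only on $\omega$ and the current state. A stationary strategy is $k$-myopic if the action depends only on the realization of the payoffs at the next $k$ positions to the right of the current position; $\sigma(x_1\cdots x_k)=i$ means that action $i$ is played at state $z$ whenever $g_\omega(z+j)=x_j$ for $1\le j\le k$. Letters $a,b$ are placeholders for $0$ or $1$ (a repeated letter means equal payoffs). "Optimal" means 0-optimal: for every initial state $z$, $\gamma_n(z,\sigma)\to v_\infty(p)$ as $n\to\infty$, $\mathbb{P}$-a.s. *)

theory Defs
  imports "HOL-Probability.Probability"
begin

text \<open>
  The payoff attached to the vertex \<open>z\<close> in the realization \<open>\<omega>\<close> is \<open>g z \<omega>\<close>.
  Stages are numbered from 0 throughout: stage \<open>m\<close> here is stage \<open>m + 1\<close> in the usual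
  numbering.
\<close>

definition iid_bernoulli :: "'w measure \<Rightarrow> real \<Rightarrow> (int \<Rightarrow> 'w \<Rightarrow> real) \<Rightarrow> bool" where
  "iid_bernoulli M p g \<longleftrightarrow>
     prob_space.indep_vars M (\<lambda>_. borel) g UNIV \<and>
     (\<forall>z. distr M borel (g z) = distr (measure_pmf (bernoulli_pmf p)) borel of_bool)"

definition payoff_algebra :: "'w measure \<Rightarrow> (int \<Rightarrow> 'w \<Rightarrow> real) \<Rightarrow> 'w measure" where
  "payoff_algebra M g =
     sigma (space M) (\<Union>z. {g z -` A \<inter> space M | A. A \<in> sets borel})"

text \<open>
  The integer argument of \<open>\<sigma> m \<omega> z\<close> is the initial state, not the current one; the dependence
  on the past is implicit because \<open>\<omega>\<close> is known and the transitions are deterministic.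
\<close>

type_synonym 'w strategy = "nat \<Rightarrow> 'w \<Rightarrow> int \<Rightarrow> int"

definition strategies :: "'w measure \<Rightarrow> (int \<Rightarrow> 'w \<Rightarrow> real) \<Rightarrow> int set \<Rightarrow> 'w strategy set" where
  "strategies M g I =
     {\<sigma>. \<forall>m. case_prod (\<sigma> m) \<in> payoff_algebra M g \<Otimes>\<^sub>M count_space UNIV \<rightarrow>\<^sub>M count_space I}"

primrec state :: "'w strategy \<Rightarrow> int \<Rightarrow> 'w \<Rightarrow> nat \<Rightarrow> int" where
  "state \<sigma> z \<omega> 0 = z"
| "state \<sigma> z \<omega> (Suc m) = state \<sigma> z \<omega> m + \<sigma> m \<omega> z"

definition mean_payoff ::
    "(int \<Rightarrow> 'w \<Rightarrow> real) \<Rightarrow> nat \<Rightarrow> int \<Rightarrow> 'w strategy \<Rightarrow> 'w \<Rightarrow> real" where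
  "mean_payoff g n z \<sigma> \<omega> =
     1 / real n * (\<Sum>m<n. g (state \<sigma> z \<omega> m + \<sigma> m \<omega> z) \<omega>)"

definition stage_value ::
    "'w measure \<Rightarrow> (int \<Rightarrow> 'w \<Rightarrow> real) \<Rightarrow> int set \<Rightarrow> nat \<Rightarrow> int \<Rightarrow> 'w \<Rightarrow> real" where
  "stage_value M g I n z \<omega> = Max ((\<lambda>\<sigma>. mean_payoff g n z \<sigma> \<omega>) ` strategies M g I)"

text \<open>The maximum is over a finite non-empty set of values, hence attained.\<close>

lemma strategies_nonempty:
  assumes "I \<noteq> {}"
  shows "strategies M g I \<noteq> {}"
proof -
  obtain i where "i \<in> I" using assms by blast
  then have "(\<lambda>_ _ _. i) \<in> strategies M g I"
    by (simp add: strategies_def case_prod_unfold)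
  then show ?thesis by blast
qed

lemma strategy_action:
  assumes "\<sigma> \<in> strategies M g I" "\<omega> \<in> space M"
  shows "\<sigma> m \<omega> z \<in> I"
proof -
  have "case_prod (\<sigma> m) \<in> payoff_algebra M g \<Otimes>\<^sub>M count_space UNIV \<rightarrow>\<^sub>M count_space I"
    using assms by (simp add: strategies_def)
  moreover have "space (payoff_algebra M g) = space M"
    unfolding payoff_algebra_def by (rule space_measure_of) auto
  then have "(\<omega>, z) \<in> space (payoff_algebra M g \<Otimes>\<^sub>M count_space UNIV)"
    using assms(2) by (simp add: space_pair_measure)
  ultimately have "case_prod (\<sigma> m) (\<omega>, z) \<in> space (count_space I)"
    by (rule measurable_space)
  then show ?thesis by simp
qed

lemma finite_mean_payoffs:
  assumes "finite I" "\<omega> \<in> space M"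
  shows "finite ((\<lambda>\<sigma>. mean_payoff g n z \<sigma> \<omega>) ` strategies M g I)"
proof (rule finite_subset)
  let ?F = "\<lambda>a. 1 / real n * (\<Sum>m<n. g (z + (\<Sum>k\<le>m. a k)) \<omega>)"
  show "finite (?F ` (PiE {..<n} (\<lambda>_. I)))"
    using assms by (auto intro: finite_PiE)
  show "(\<lambda>\<sigma>. mean_payoff g n z \<sigma> \<omega>) ` strategies M g I \<subseteq> ?F ` (PiE {..<n} (\<lambda>_. I))"
  proof clarify
    fix \<sigma> assume s: "\<sigma> \<in> strategies M g I"
    let ?a = "restrict (\<lambda>k. \<sigma> k \<omega> z) {..<n}"
    have st: "state \<sigma> z \<omega> m = z + (\<Sum>k<m. \<sigma> k \<omega> z)" for m
      by (induction m) auto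
    have "(\<Sum>k\<le>m. ?a k) = (\<Sum>k<m. \<sigma> k \<omega> z) + \<sigma> m \<omega> z" if "m < n" for m
    proof -
      have "(\<Sum>k\<le>m. ?a k) = (\<Sum>k\<le>m. \<sigma> k \<omega> z)"
        using that by (intro sum.cong) auto
      then show ?thesis by (simp flip: lessThan_Suc_atMost)
    qed
    then have "mean_payoff g n z \<sigma> \<omega> = ?F ?a"
      unfolding mean_payoff_def st by (auto intro!: sum.cong simp: add.assoc)
    moreover have "?a \<in> PiE {..<n} (\<lambda>_. I)"
      using strategy_action[OF s assms(2)] by auto
    ultimately show "mean_payoff g n z \<sigma> \<omega> \<in> ?F ` (PiE {..<n} (\<lambda>_. I))" by blast
  qed
qed

definition has_limit_value ::
    "'w measure \<Rightarrow> (int \<Rightarrow> 'w \<Rightarrow> real) \<Rightarrow> int set \<Rightarrow> real \<Rightarrow> bool" where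
  "has_limit_value M g I v \<longleftrightarrow>
     (\<forall>z. AE \<omega> in M. (\<lambda>n. stage_value M g I n z \<omega>) \<longlonglongrightarrow> v)"

definition optimal ::
    "'w measure \<Rightarrow> (int \<Rightarrow> 'w \<Rightarrow> real) \<Rightarrow> int set \<Rightarrow> 'w strategy \<Rightarrow> bool" where
  "optimal M g I \<sigma> \<longleftrightarrow>
     \<sigma> \<in> strategies M g I \<and>
     (\<exists>v. has_limit_value M g I v \<and>
          (\<forall>z. AE \<omega> in M. (\<lambda>n. mean_payoff g n z \<sigma> \<omega>) \<longlonglongrightarrow> v))"

text \<open>
  A stationary rule \<open>s\<close> prescribes the action \<open>s \<omega> y\<close> whenever the current state is \<open>y\<close>;
  \<open>stationary_strategy s\<close> is the strategy it generates.
\<close>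

primrec stationary_state :: "('w \<Rightarrow> int \<Rightarrow> int) \<Rightarrow> 'w \<Rightarrow> int \<Rightarrow> nat \<Rightarrow> int" where
  "stationary_state s \<omega> z 0 = z"
| "stationary_state s \<omega> z (Suc m) =
     stationary_state s \<omega> z m + s \<omega> (stationary_state s \<omega> z m)"

definition stationary_strategy :: "('w \<Rightarrow> int \<Rightarrow> int) \<Rightarrow> 'w strategy" where
  "stationary_strategy s m \<omega> z = s \<omega> (stationary_state s \<omega> z m)"

definition myopic_strategy ::
    "(int \<Rightarrow> 'w \<Rightarrow> real) \<Rightarrow> nat \<Rightarrow> (real list \<Rightarrow> int) \<Rightarrow> 'w strategy" where
  "myopic_strategy g k f =
     stationary_strategy (\<lambda>\<omega> y. f (map (\<lambda>j. g (y + int j) \<omega>) [1..<Suc k]))"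

text \<open>
  The last branch is \<open>abb1\<close> on words over \<open>{0, 1}\<close>. It also assigns an action to all other
  lists, which occur with probability 0 only.
\<close>

definition sigma_star :: "real list \<Rightarrow> int" where
  "sigma_star xs =
     (case xs of
        [a, x, y, b] \<Rightarrow>
          (if x = 0 \<and> y = 1 then 3
           else if x = 1 \<and> y = 0 then 2
           else if x = y \<and> b = 0 then 3
           else 2)
      | _ \<Rightarrow> 2)"

end

theory Submission
  imports Defs
begin

text \<open>
  Fix a realization and a charge \<open>c\<close> with \<open>0 \<le> c \<le> 1\<close> per stage. If a path of jumps 2 and 3 starts
  with the action not prescribed by \<open>\<sigma>\<^sup>*\<close>, its first three jumps can be replaced by two to four
  jumps with the same end point, the first one as prescribed, without lowering the sum of
  payoff minus \<open>c\<close>. Iterating, every path is beaten up to a constant by the path of \<open>\<sigma>\<^sup>*\<close>, run for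
  a possibly different number of stages. With \<open>c\<close> the limiting mean payoff of \<open>\<sigma>\<^sup>*\<close> this bounds
  all strategies by \<open>c + o(1)\<close>.

  The limiting mean payoff of \<open>\<sigma>\<^sup>*\<close> comes from reading the payoffs from left to right: the
  path of \<open>\<sigma>\<^sup>*\<close> is driven by a six-state automaton, one letter at a time. A solution of its Poisson
  equation turns the accumulated payoff minus \<open>c\<close> into a bounded perturbation of a martingale
  with bounded increments, which grows sublinearly almost surely.
\<close>

section \<open>A law of large numbers\<close>

text \<open>Orthogonality makes the second moment of the partial sums grow at most linearly, so the
  squared averages along perfect squares have summable expectations. Boundedness of the terms then
  controls the gaps between squares.\<close>

lemma (in prob_space) orthogonal_bounded_slln:
  fixes D :: "nat \<Rightarrow> 'a \<Rightarrow> real"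
  assumes meas [measurable]: "\<And>n. D n \<in> borel_measurable M"
    and bd: "\<And>n \<omega>. \<omega> \<in> space M \<Longrightarrow> \<bar>D n \<omega>\<bar> \<le> B"
    and orth: "\<And>i j. i < j \<Longrightarrow> expectation (\<lambda>\<omega>. D i \<omega> * D j \<omega>) = 0"
  shows "AE \<omega> in M. (\<lambda>n. (\<Sum>i<n. D i \<omega>) / real n) \<longlonglongrightarrow> 0"
proof -
  define S where "S n \<omega> = (\<Sum>i<n. D i \<omega>)" for n \<omega>
  have S_meas [measurable]: "S n \<in> borel_measurable M" for n
    unfolding S_def by measurable
  have B0: "0 \<le> B"
    using not_empty bd by (metis abs_ge_zero all_not_in_conv order_trans)
  have S_diff: "\<bar>S n \<omega> - S k \<omega>\<bar> \<le> B * real (n - k)" if "k \<le> n" "\<omega> \<in> space M" for n k \<omega>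
  proof -
    have "S n \<omega> - S k \<omega> = (\<Sum>i=k..<n. D i \<omega>)"
      unfolding S_def using sum_diff_nat_ivl[of 0 k n "\<lambda>i. D i \<omega>"] that
      by (simp add: atLeast0LessThan)
    also have "\<bar>\<dots>\<bar> \<le> (\<Sum>i=k..<n. \<bar>D i \<omega>\<bar>)" by (rule sum_abs)
    also have "\<dots> \<le> (\<Sum>i=k..<n. B)" using that bd by (intro sum_mono) auto
    finally show ?thesis by (simp add: mult.commute)
  qed
  have S_bd: "\<bar>S n \<omega>\<bar> \<le> B * real n" if "\<omega> \<in> space M" for n \<omega>
    using S_diff[of 0 n \<omega>] that by (simp add: S_def)
  have int_DD: "integrable M (\<lambda>\<omega>. D i \<omega> * D j \<omega>)" for i j
    by (rule integrable_const_bound[where B = "B * B"])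
      (auto simp: abs_mult B0 intro!: AE_I2 mult_mono bd)
  have int_SD: "integrable M (\<lambda>\<omega>. S n \<omega> * D j \<omega>)" for n j
    unfolding S_def sum_distrib_right by (intro Bochner_Integration.integrable_sum int_DD)
  have int_SS: "integrable M (\<lambda>\<omega>. (S n \<omega>)\<^sup>2)" for n
  proof (rule integrable_const_bound[where B = "(B * real n)\<^sup>2"])
    show "AE \<omega> in M. norm ((S n \<omega>)\<^sup>2) \<le> (B * real n)\<^sup>2"
      using S_bd by (intro AE_I2) (simp add: abs_le_square_iff[symmetric] B0)
  qed simp
  have var: "expectation (\<lambda>\<omega>. (S n \<omega>)\<^sup>2) \<le> real n * B\<^sup>2" for n
  proof (induction n)
    case 0
    then show ?case by (simp add: S_def)
  next
    case (Suc n)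
    have SD: "expectation (\<lambda>\<omega>. S n \<omega> * D n \<omega>) = 0"
      unfolding S_def sum_distrib_right
      by (subst Bochner_Integration.integral_sum) (auto intro: int_DD simp: orth)
    have DD: "expectation (\<lambda>\<omega>. D n \<omega> * D n \<omega>) \<le> B\<^sup>2"
    proof -
      have "expectation (\<lambda>\<omega>. D n \<omega> * D n \<omega>) \<le> expectation (\<lambda>_. B\<^sup>2)"
      proof (rule integral_mono[OF int_DD])
        fix \<omega> assume "\<omega> \<in> space M"
        then have "\<bar>D n \<omega>\<bar> * \<bar>D n \<omega>\<bar> \<le> B * B"
          by (intro mult_mono bd) (use B0 in auto)
        then show "D n \<omega> * D n \<omega> \<le> B\<^sup>2"
          by (simp add: power2_eq_square)
      qed simp
      then show ?thesis by (simp add: prob_space)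
    qed
    have "(\<lambda>\<omega>. (S (Suc n) \<omega>)\<^sup>2) = (\<lambda>\<omega>. (S n \<omega>)\<^sup>2 + (2 * (S n \<omega> * D n \<omega>) + D n \<omega> * D n \<omega>))"
      by (rule ext) (simp add: S_def power2_eq_square algebra_simps)
    then have "expectation (\<lambda>\<omega>. (S (Suc n) \<omega>)\<^sup>2)
        = expectation (\<lambda>\<omega>. (S n \<omega>)\<^sup>2) + expectation (\<lambda>\<omega>. D n \<omega> * D n \<omega>)"
      by (simp add: int_SS int_SD int_DD SD)
    then show ?case using Suc DD by (simp add: algebra_simps)
  qed
  txt \<open>By the variance bound \<open>S\<close> is sublinear along the squares, and \<open>S\<close> moves by at most \<open>2 B k\<close>
    between consecutive squares.\<close>
  define Y where "Y k \<omega> = (S ((Suc k)\<^sup>2) \<omega> / real ((Suc k)\<^sup>2))\<^sup>2" for k \<omega>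
  have Y_meas [measurable]: "Y k \<in> borel_measurable M" for k
    unfolding Y_def by measurable
  have Y_int: "(\<integral>\<^sup>+ \<omega>. ennreal (Y k \<omega>) \<partial>M) \<le> ennreal (B\<^sup>2 * (1 / real ((Suc k)\<^sup>2)))" for k
  proof -
    have Yeq: "Y k = (\<lambda>\<omega>. (1 / real ((Suc k)\<^sup>2))\<^sup>2 * (S ((Suc k)\<^sup>2) \<omega>)\<^sup>2)"
      by (rule ext) (simp add: Y_def power_divide)
    have Y_integrable: "integrable M (Y k)"
      unfolding Yeq by (intro integrable_mult_right int_SS)
    then have "(\<integral>\<^sup>+ \<omega>. ennreal (Y k \<omega>) \<partial>M) = ennreal (expectation (Y k))"
      by (rule nn_integral_eq_integral) (simp add: Y_def)
    also have "expectation (Y k) = (1 / real ((Suc k)\<^sup>2))\<^sup>2 * expectation (\<lambda>\<omega>. (S ((Suc k)\<^sup>2) \<omega>)\<^sup>2)"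
      unfolding Yeq by simp
    also have "\<dots> \<le> (1 / real ((Suc k)\<^sup>2))\<^sup>2 * (real ((Suc k)\<^sup>2) * B\<^sup>2)"
      by (intro mult_left_mono var) auto
    also have "\<dots> = B\<^sup>2 * (1 / real ((Suc k)\<^sup>2))"
      by (simp add: power2_eq_square)
    finally show ?thesis by (simp add: ennreal_leI)
  qed
  have "summable (\<lambda>k. 1 / real (k\<^sup>2))"
    using inverse_power_summable[of 2, where 'a = real] by (simp add: inverse_eq_divide)
  then have "summable (\<lambda>k. 1 / real ((Suc k)\<^sup>2))"
    by (subst summable_Suc_iff[where f = "\<lambda>k. 1 / real (k\<^sup>2)"])
  then have sq_summable: "summable (\<lambda>k. B\<^sup>2 * (1 / real ((Suc k)\<^sup>2)))"
    by (rule summable_mult)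
  have "(\<integral>\<^sup>+ \<omega>. (\<Sum>k. ennreal (Y k \<omega>)) \<partial>M) = (\<Sum>k. \<integral>\<^sup>+ \<omega>. ennreal (Y k \<omega>) \<partial>M)"
    by (intro nn_integral_suminf) auto
  also have "\<dots> \<le> (\<Sum>k. ennreal (B\<^sup>2 * (1 / real ((Suc k)\<^sup>2))))"
    by (intro suminf_le Y_int) auto
  also have "\<dots> = ennreal (\<Sum>k. B\<^sup>2 * (1 / real ((Suc k)\<^sup>2)))"
    by (intro suminf_ennreal2 sq_summable) auto
  also have "\<dots> < \<infinity>" by simp
  finally have "(\<integral>\<^sup>+ \<omega>. (\<Sum>k. ennreal (Y k \<omega>)) \<partial>M) \<noteq> \<infinity>" by simp
  \<comment> \<open>A nonnegative series with finite expectation is finite almost surely, so its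
    terms, the squared averages along squares, tend to 0.\<close>
  then have "AE \<omega> in M. (\<Sum>k. ennreal (Y k \<omega>)) \<noteq> \<infinity>"
    by (intro nn_integral_PInf_AE) auto
  then show ?thesis
  proof (rule AE_mp, intro AE_I2 impI)
    fix \<omega> assume \<omega>: "\<omega> \<in> space M" and fin: "(\<Sum>k. ennreal (Y k \<omega>)) \<noteq> \<infinity>"
    have "summable (\<lambda>k. Y k \<omega>)"
      using fin by (intro summable_suminf_not_top) (auto simp: Y_def)
    then have "(\<lambda>k. Y k \<omega>) \<longlonglongrightarrow> 0" by (rule summable_LIMSEQ_zero)
    then have "(\<lambda>k. sqrt (Y k \<omega>)) \<longlonglongrightarrow> sqrt 0" by (rule tendsto_real_sqrt)
    then have "(\<lambda>k. \<bar>S ((Suc k)\<^sup>2) \<omega>\<bar> / real ((Suc k)\<^sup>2)) \<longlonglongrightarrow> 0"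
      by (simp add: Y_def real_sqrt_abs)
    then have sub: "(\<lambda>k. \<bar>S (k\<^sup>2) \<omega>\<bar> / real (k\<^sup>2)) \<longlonglongrightarrow> 0"
      by (rule LIMSEQ_imp_Suc)
    \<comment> \<open>\<open>(K n)^2\<close> is the largest perfect square not exceeding
      \<open>n\<close>.\<close>
    define K where "K n = nat \<lfloor>sqrt (real n)\<rfloor>" for n
    have "filterlim K at_top sequentially"
      unfolding K_def
      by (intro filterlim_compose[OF filterlim_nat_sequentially]
          filterlim_compose[OF filterlim_floor_sequentially]
          filterlim_compose[OF sqrt_at_top] filterlim_real_sequentially)
    then have "(\<lambda>n. \<bar>S ((K n)\<^sup>2) \<omega>\<bar> / real ((K n)\<^sup>2)) \<longlonglongrightarrow> 0"
      by (rule filterlim_compose[OF sub])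
    moreover have "(\<lambda>n. 2 * B / sqrt (real n)) \<longlonglongrightarrow> 0"
      by (intro real_tendsto_divide_at_top[OF tendsto_const]
          filterlim_compose[OF sqrt_at_top] filterlim_real_sequentially)
    ultimately have lim: "(\<lambda>n. \<bar>S ((K n)\<^sup>2) \<omega>\<bar> / real ((K n)\<^sup>2) + 2 * B / sqrt (real n)) \<longlonglongrightarrow> 0"
      using tendsto_add by fastforce
    have bound: "\<bar>S n \<omega> / real n\<bar> \<le> \<bar>S ((K n)\<^sup>2) \<omega>\<bar> / real ((K n)\<^sup>2) + 2 * B / sqrt (real n)"
      if "n \<ge> 1" for n
    proof -
      let ?s = "sqrt (real n)"
      have s1: "1 \<le> ?s" using that by simp
      have Ks: "real (K n) \<le> ?s" "?s < real (K n) + 1"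
        unfolding K_def using s1 by linarith+
      have ss: "?s * ?s = real n" by simp
      have "real (K n) * real (K n) \<le> ?s * ?s"
        by (intro mult_mono Ks) auto
      then have Kn: "(K n)\<^sup>2 \<le> n"
        unfolding ss power2_eq_square by (simp flip: of_nat_mult)
      have K1: "1 \<le> K n" using s1 Ks by linarith
      \<comment> \<open>The first factor is at most 1 and the second at most twice the root of
        \<open>n\<close>, so the distance from \<open>n\<close> to the preceding square is
        negligible against \<open>n\<close>.\<close>
      have "?s * ?s - real (K n) * real (K n) = (?s - real (K n)) * (?s + real (K n))"
        by (simp add: algebra_simps)
      also have "\<dots> \<le> 1 * (2 * ?s)"
        using Ks by (intro mult_mono) auto
      finally have gap: "real (n - (K n)\<^sup>2) \<le> 2 * ?s"
        using Kn by (simp add: ss of_nat_diff power2_eq_square)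
      have "\<bar>S n \<omega>\<bar> \<le> \<bar>S ((K n)\<^sup>2) \<omega>\<bar> + B * real (n - (K n)\<^sup>2)"
        using S_diff[OF Kn \<omega>] by linarith
      also have "\<dots> \<le> \<bar>S ((K n)\<^sup>2) \<omega>\<bar> + B * (2 * ?s)"
        using gap B0 by (intro add_left_mono mult_left_mono)
      finally have "\<bar>S n \<omega>\<bar> / real n \<le> (\<bar>S ((K n)\<^sup>2) \<omega>\<bar> + B * (2 * ?s)) / real n"
        by (intro divide_right_mono) auto
      also have "\<dots> = \<bar>S ((K n)\<^sup>2) \<omega>\<bar> / real n + 2 * B / ?s"
      proof -
        have "B * (2 * ?s) / real n = B * (2 * ?s) / (?s * ?s)" by simp
        also have "\<dots> = 2 * B / ?s" using s1 by (simp add: field_simps del: real_sqrt_mult_self)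
        finally show ?thesis by (simp add: add_divide_distrib)
      qed
      also have "\<dots> \<le> \<bar>S ((K n)\<^sup>2) \<omega>\<bar> / real ((K n)\<^sup>2) + 2 * B / ?s"
        using Kn K1 that by (intro add_right_mono divide_left_mono) (auto simp flip: of_nat_power)
      finally show ?thesis by simp
    qed
    have "(\<lambda>n. S n \<omega> / real n) \<longlonglongrightarrow> 0"
      by (rule tendsto_rabs_zero_cancel, rule tendsto_sandwich[OF _ _ tendsto_const lim])
        (use bound in \<open>auto intro!: eventually_sequentiallyI[of 1]\<close>)
    then show "(\<lambda>n. (\<Sum>i<n. D i \<omega>) / real n) \<longlonglongrightarrow> 0" by (simp add: S_def)
  qed
qed

text \<open>The two factors depend on the disjoint blocks of letters \<open>{..<n}\<close> and
  \<open>{n}\<close>. A finite product of discrete two-point spaces is again discrete, so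
  \<open>f\<close> is automatically measurable on its block.\<close>

lemma (in prob_space) expectation_past_times_present:
  fixes X :: "nat \<Rightarrow> 'a \<Rightarrow> bool" and f :: "(nat \<Rightarrow> bool) \<Rightarrow> real" and u :: "bool \<Rightarrow> real"
  assumes indep: "indep_vars (\<lambda>_. count_space UNIV) X UNIV"
    and past: "\<And>x y. (\<And>i. i < n \<Longrightarrow> x i = y i) \<Longrightarrow> f x = f y"
    and bd: "\<And>x. \<bar>f x\<bar> \<le> B"
  shows "(\<lambda>\<omega>. f (\<lambda>i. X i \<omega>)) \<in> borel_measurable M" (is ?meas)
    and "expectation (\<lambda>\<omega>. f (\<lambda>i. X i \<omega>) * u (X n \<omega>))
       = expectation (\<lambda>\<omega>. f (\<lambda>i. X i \<omega>)) * expectation (\<lambda>\<omega>. u (X n \<omega>))" (is ?exp)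
proof -
  let ?N = "\<lambda>_::nat. count_space (UNIV :: bool set)"
  have "indep_var (PiM {..<n} ?N) (\<lambda>\<omega>. restrict (\<lambda>i. X i \<omega>) {..<n})
      (PiM {n} ?N) (\<lambda>\<omega>. restrict (\<lambda>i. X i \<omega>) {n})"
    by (rule indep_var_restrict[OF indep]) auto
  then have "indep_var borel (f \<circ> (\<lambda>\<omega>. restrict (\<lambda>i. X i \<omega>) {..<n}))
      borel ((\<lambda>x. u (x n)) \<circ> (\<lambda>\<omega>. restrict (\<lambda>i. X i \<omega>) {n}))"
    by (rule indep_var_compose) (auto simp: count_space_PiM_finite)
  \<comment> \<open>Outside the block \<open>restrict\<close> returns \<open>undefined\<close>,
    which \<open>f\<close> does not see by \<open>past\<close>.\<close>
  moreover have "f (restrict (\<lambda>i. X i \<omega>) {..<n}) = f (\<lambda>i. X i \<omega>)" for \<omega>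
    by (rule past) simp
  ultimately have iv: "indep_var borel (\<lambda>\<omega>. f (\<lambda>i. X i \<omega>)) borel (\<lambda>\<omega>. u (X n \<omega>))"
    by (simp add: comp_def)
  then show ?meas by (rule indep_var_rv1)
  have "\<bar>u b\<bar> \<le> max \<bar>u True\<bar> \<bar>u False\<bar>" for b by (cases b) auto
  then show ?exp
    using iv bd
    by (intro indep_var_lebesgue_integral integrable_const_bound[where B = B]
        integrable_const_bound[where B = "max \<bar>u True\<bar> \<bar>u False\<bar>"])
      (auto dest: indep_var_rv1 indep_var_rv2)
qed

text \<open>For \<open>i < j\<close>, the term at \<open>i\<close> times the coefficient at
  \<open>j\<close> involves only letters before \<open>j\<close>. It is therefore independent of the
  centred letter at \<open>j\<close>, which has mean 0, and the terms are orthogonal.\<close>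

lemma (in prob_space) predictable_bernoulli_slln:
  fixes X :: "nat \<Rightarrow> 'a \<Rightarrow> bool" and \<psi> :: "nat \<Rightarrow> (nat \<Rightarrow> bool) \<Rightarrow> real"
  assumes indep: "indep_vars (\<lambda>_. count_space UNIV) X UNIV"
    and mean: "\<And>n. expectation (\<lambda>\<omega>. of_bool (X n \<omega>)) = p"
    and past: "\<And>n x y. (\<And>i. i < n \<Longrightarrow> x i = y i) \<Longrightarrow> \<psi> n x = \<psi> n y"
    and bd: "\<And>n x. \<bar>\<psi> n x\<bar> \<le> B"
  shows "AE \<omega> in M. (\<lambda>n. (\<Sum>i<n. \<psi> i (\<lambda>k. X k \<omega>) * (of_bool (X i \<omega>) - p)) / real n) \<longlonglongrightarrow> 0"
proof (rule orthogonal_bounded_slln)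
  define d where "d i x = \<psi> i x * (of_bool (x i) - p)" for i and x :: "nat \<Rightarrow> bool"
  have B0: "0 \<le> B" using bd abs_ge_zero order_trans by blast
  have X_meas [measurable]: "X n \<in> measurable M (count_space UNIV)" for n
    using indep by (auto simp: indep_vars_def)
  have \<psi>_meas [measurable]: "(\<lambda>\<omega>. \<psi> n (\<lambda>k. X k \<omega>)) \<in> borel_measurable M" for n
    by (rule expectation_past_times_present(1)[OF indep, where n = n and B = B])
      (auto intro: past bd)
  show "(\<lambda>\<omega>. \<psi> n (\<lambda>k. X k \<omega>) * (of_bool (X n \<omega>) - p)) \<in> borel_measurable M" for n
    by measurable
  have d_bd: "\<bar>d n x\<bar> \<le> B * (1 + \<bar>p\<bar>)" for n x
    unfolding d_def abs_mult using B0 by (intro mult_mono bd) (auto simp: of_bool_def)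
  then show "\<bar>\<psi> n (\<lambda>k. X k \<omega>) * (of_bool (X n \<omega>) - p)\<bar> \<le> B * (1 + \<bar>p\<bar>)" for n \<omega>
    unfolding d_def by blast
  fix i j :: nat assume "i < j"
  have "integrable M (\<lambda>\<omega>. of_bool (X j \<omega>) :: real)"
    by (rule integrable_const_bound[where B = 1]) auto
  then have zero: "expectation (\<lambda>\<omega>. of_bool (X j \<omega>) - p) = 0"
    by (simp add: mean prob_space)
  have "expectation (\<lambda>\<omega>. (d i (\<lambda>k. X k \<omega>) * \<psi> j (\<lambda>k. X k \<omega>)) * (of_bool (X j \<omega>) - p))
      = expectation (\<lambda>\<omega>. d i (\<lambda>k. X k \<omega>) * \<psi> j (\<lambda>k. X k \<omega>)) * expectation (\<lambda>\<omega>. of_bool (X j \<omega>) - p)"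
  proof (rule expectation_past_times_present(2)[OF indep, where B = "B * (1 + \<bar>p\<bar>) * B"])
    fix x y :: "nat \<Rightarrow> bool" assume "\<And>i. i < j \<Longrightarrow> x i = y i"
    then show "d i x * \<psi> j x = d i y * \<psi> j y"
      using \<open>i < j\<close> past[of i x y] past[of j x y] by (simp add: d_def)
  next
    show "\<bar>d i x * \<psi> j x\<bar> \<le> B * (1 + \<bar>p\<bar>) * B" for x
      unfolding abs_mult using B0 by (intro mult_mono bd d_bd) auto
  qed
  then show "expectation (\<lambda>\<omega>. \<psi> i (\<lambda>k. X k \<omega>) * (of_bool (X i \<omega>) - p)
      * (\<psi> j (\<lambda>k. X k \<omega>) * (of_bool (X j \<omega>) - p))) = 0"
    by (simp add: zero d_def mult.assoc)
qed

section \<open>The exchange argument\<close>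

definition act :: "(int \<Rightarrow> real) \<Rightarrow> int \<Rightarrow> int" where
  "act w y = sigma_star [w (y + 1), w (y + 2), w (y + 3), w (y + 4)]"

primrec pos :: "(int \<Rightarrow> real) \<Rightarrow> int \<Rightarrow> nat \<Rightarrow> int" where
  "pos w z 0 = z"
| "pos w z (Suc m) = pos w z m + act w (pos w z m)"

definition binary :: "(int \<Rightarrow> real) \<Rightarrow> bool" where
  "binary w \<longleftrightarrow> (\<forall>y. w y = 0 \<or> w y = 1)"

lemma act_eq:
  "act w y = (if w (y + 2) = 0 \<and> w (y + 3) = 1 then 3
     else if w (y + 2) = 1 \<and> w (y + 3) = 0 then 2
     else if w (y + 2) = w (y + 3) \<and> w (y + 4) = 0 then 3 else 2)"
  by (simp add: act_def sigma_star_def)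

lemma act_cases: "act w y = 2 \<or> act w y = 3"
  by (simp add: act_eq)

lemma pos_Suc_shift: "pos w (z + act w z) m = pos w z (Suc m)"
  by (induction m) auto

lemma pos_bounds: "z + 2 * int m \<le> pos w z m" "pos w z m \<le> z + 3 * int m"
proof -
  have "z + 2 * int m \<le> pos w z m \<and> pos w z m \<le> z + 3 * int m"
  proof (induction m)
    case (Suc m)
    then show ?case using act_cases[of w "pos w z m"] by auto
  qed simp
  then show "z + 2 * int m \<le> pos w z m" "pos w z m \<le> z + 3 * int m" by auto
qed

definition greedy_sum :: "real \<Rightarrow> (int \<Rightarrow> real) \<Rightarrow> int \<Rightarrow> nat \<Rightarrow> real" where
  "greedy_sum c w z m = (\<Sum>i<m. w (pos w z (Suc i)) - c)"

primrec path_sum :: "real \<Rightarrow> (int \<Rightarrow> real) \<Rightarrow> int \<Rightarrow> int list \<Rightarrow> real" where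
  "path_sum c w z [] = 0"
| "path_sum c w z (i # is) = w (z + i) - c + path_sum c w (z + i) is"

lemma greedy_sum_Suc:
  "greedy_sum c w z (Suc m) = w (z + act w z) - c + greedy_sum c w (z + act w z) m"
  unfolding greedy_sum_def pos_Suc_shift by (subst sum.lessThan_Suc_shift) simp

lemma path_sum_append:
  "path_sum c w z (is @ js) = path_sum c w z is + path_sum c w (z + sum_list is) js"
  by (induction "is" arbitrary: z) (auto simp: algebra_simps)

text \<open>Between \<open>z + 2\<close> and \<open>z + 3\<close> the prescribed jump picks the
  better vertex; a tie is broken so as to land on, or avoid, \<open>z + 4\<close> according to its
  payoff. Exchanges that drop a stage rely on \<open>0 \<le> c\<close>, those that add one on
  \<open>c \<le> 1\<close>.\<close>

lemma exchange_first_action: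
  assumes w: "binary w" and c: "0 \<le> c" "c \<le> 1"
    and len: "3 \<le> length is" and sub: "set is \<subseteq> {2, 3}"
  obtains js where "sum_list (act w z # js) = sum_list is" "set js \<subseteq> {2, 3}"
    "path_sum c w z is \<le> path_sum c w z (act w z # js)"
proof -
  obtain i j k ks where eq: "is = i # j # k # ks"
    using len by (auto simp: numeral_3_eq_3 Suc_le_length_iff)
  have ijk: "i = 2 \<or> i = 3" "j = 2 \<or> j = 3" "k = 2 \<or> k = 3" and ks: "set ks \<subseteq> {2, 3}"
    using sub by (auto simp: eq)
  have w01: "w y = 0 \<or> w y = 1" for y
    using w by (simp add: binary_def)
  note w_cases = w01[of "z + 2"] w01[of "z + 3"] w01[of "z + 4"] w01[of "z + 5"]
  \<comment> \<open>The exchanges are \<open>2 3 k\<close> to \<open>3 2 k\<close>,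
    \<open>2 2 2\<close> to \<open>3 3\<close>, \<open>2 2 3\<close> to \<open>3 2 2\<close>,
    \<open>3 2 k\<close> to \<open>2 3 k\<close>, and \<open>3 3 k\<close> to
    \<open>2 2 2 k\<close>. The second loses a stage and the last gains one.\<close>
  define js where "js =
    (if i = act w z then [j, k]
     else if i = 2 then (if j = 3 then [2, k] else if k = 2 then [3] else [2, 2])
     else (if j = 2 then [3, k] else [2, 2, k])) @ ks"
  show ?thesis
  proof (rule that[of js])
    show "sum_list (act w z # js) = sum_list is"
      using ijk by (auto simp: js_def eq act_eq)
    show "set js \<subseteq> {2, 3}"
      using ijk ks by (auto simp: js_def)
    show "path_sum c w z is \<le> path_sum c w z (act w z # js)"
      using ijk w_cases c
      by (elim disjE) (auto simp: js_def eq act_eq add.assoc)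
  qed
qed

text \<open>The induction is on the total displacement, since an exchange can lengthen the word. The
  bound on \<open>m\<close> by the displacement later keeps the number of greedy stages linear in
  the number of stages played.\<close>

lemma path_sum_le_greedy_sum:
  assumes w: "binary w" and c: "0 \<le> c" "c \<le> 1" and sub: "set is \<subseteq> {2, 3}"
  shows "\<exists>m. int m \<le> sum_list is \<and> path_sum c w z is \<le> greedy_sum c w z m + 2"
  using sub
proof (induction "nat (sum_list is)" arbitrary: "is" z rule: less_induct)
  case less
  have nonneg: "0 \<le> sum_list js" if "set js \<subseteq> {2, 3}" for js :: "int list"
    using that by (intro sum_list_nonneg) auto
  show ?case
  proof (cases "3 \<le> length is")
    case True
    from exchange_first_action[OF w c this less.prems]
    obtain js where js: "sum_list (act w z # js) = sum_list is" "set js \<subseteq> {2, 3}"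
      "path_sum c w z is \<le> path_sum c w z (act w z # js)" .
    have "nat (sum_list js) < nat (sum_list is)"
      using js(1) nonneg[OF js(2)] act_cases[of w z] by auto
    from less.hyps[OF this js(2)] obtain m where m: "int m \<le> sum_list js"
      "path_sum c w (z + act w z) js \<le> greedy_sum c w (z + act w z) m + 2" by blast
    have "int (Suc m) \<le> sum_list is"
      using js(1) m(1) act_cases[of w z] by auto
    moreover have "path_sum c w z is \<le> greedy_sum c w z (Suc m) + 2"
      using js(3) m(2) by (simp add: greedy_sum_Suc)
    ultimately show ?thesis by blast
  next
    case False
    \<comment> \<open>Each jump earns at most 1, so the at most two remaining jumps account for the
      constant 2, with \<open>m = 0\<close>.\<close>
    have "path_sum c w z is \<le> real (length is)" for z "is"
    proof (induction "is" arbitrary: z)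
      case (Cons i "is")
      have "w (z + i) \<le> 1" using w by (metis binary_def order_refl zero_le_one)
      then show ?case using Cons[of "z + i"] c by simp
    qed simp
    from this[of z "is"] show ?thesis
      using False nonneg[OF less.prems] by (intro exI[of _ 0]) (simp add: greedy_sum_def)
  qed
qed

section \<open>The automaton and its bias\<close>

text \<open>
  If the walker decides at \<open>y\<close>, the automaton is in \<open>Boundary\<close> before reading vertex \<open>y + 1\<close>, in
  \<open>Skip\<close> before \<open>y + 2\<close>, in \<open>Seen a\<close> before \<open>y + 3\<close> when \<open>y + 2\<close> carries \<open>a\<close>, and in \<open>Tie a\<close> before
  \<open>y + 4\<close> when \<open>y + 2\<close> and \<open>y + 3\<close> both carry \<open>a\<close>. A decision is credited when its last relevant
  letter is read; the phase reached then already refers to the new decision point, some of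
  whose letters may be known.
\<close>
datatype phase = Boundary | Skip | Seen bool | Tie bool

text \<open>After a mismatch the last letter read, at \<open>y + 3\<close>, is the new decision
  point itself (jump 3) or the vertex next to it (jump 2). After a tie the last letter, at
  \<open>y + 4\<close>, lies two past the new point if it is 1 (jump 2), and one past it if it is 0
  (jump 3).\<close>

fun phase_step :: "phase \<Rightarrow> bool \<Rightarrow> phase" where
  "phase_step Boundary b = Skip"
| "phase_step Skip b = Seen b"
| "phase_step (Seen a) b = (if a = b then Tie a else if b then Boundary else Skip)"
| "phase_step (Tie a) b = (if b then Seen True else Skip)"

text \<open>A mismatch leads to the vertex carrying 1. In a tie both candidate vertices carry
  \<open>a\<close>, so the reward does not depend on the jump.\<close>

fun phase_reward :: "real \<Rightarrow> phase \<Rightarrow> bool \<Rightarrow> real" where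
  "phase_reward c (Seen a) b = (if a = b then 0 else 1 - c)"
| "phase_reward c (Tie a) b = of_bool a - c"
| "phase_reward c s b = 0"

primrec run :: "(nat \<Rightarrow> bool) \<Rightarrow> nat \<Rightarrow> phase" where
  "run x 0 = Boundary"
| "run x (Suc n) = phase_step (run x n) (x n)"

definition run_reward :: "real \<Rightarrow> (nat \<Rightarrow> bool) \<Rightarrow> nat \<Rightarrow> real" where
  "run_reward c x n = (\<Sum>i<n. phase_reward c (run x i) (x i))"

lemma run_cong: "(\<And>i. i < n \<Longrightarrow> x i = y i) \<Longrightarrow> run x n = run y n"
  by (induction n) auto

text \<open>Every decision passes through \<open>Seen\<close> just after the vertex two past the
  decision point is read, and exactly one credit occurs between consecutive such moments. Letter
  \<open>i\<close> sits at vertex \<open>z + 1 + i\<close>, whence the offset 2 in the number of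
  letters read.\<close>

lemma run_greedy:
  fixes w :: "int \<Rightarrow> real" and z :: int
  assumes w: "binary w"
  defines "x \<equiv> \<lambda>i. w (z + 1 + int i) = 1"
  shows "run x (nat (pos w z m - z) + 2) = Seen (w (pos w z m + 2) = 1)
    \<and> run_reward c x (nat (pos w z m - z) + 2) = greedy_sum c w z m"
proof (induction m)
  case 0
  then show ?case
    by (simp add: x_def run_reward_def greedy_sum_def numeral_2_eq_2 add.commute)
next
  case (Suc m)
  define y where "y = pos w z m"
  define N where "N = nat (y - z) + 2"
  have y: "y = z + int N - 2"
    using pos_bounds(1)[where w = w and z = z and m = m] by (simp add: N_def y_def)
  have letters: "x N = (w (y + 3) = 1)" "x (Suc N) = (w (y + 4) = 1)"
    "x (Suc (Suc N)) = (w (y + 5) = 1)"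
    by (simp_all add: x_def y algebra_simps)
  have w01: "w y = 0 \<or> w y = 1" for y
    using w by (simp add: binary_def)
  have IH: "run x N = Seen (w (y + 2) = 1)" "run_reward c x N = greedy_sum c w z m"
    using Suc by (simp_all add: y_def N_def)
  have step: "run x (Suc i) = phase_step (run x i) (x i)"
    "run_reward c x (Suc i) = run_reward c x i + phase_reward c (run x i) (x i)" for i
    by (simp_all add: run_reward_def)
  have P: "pos w z (Suc m) = y + act w y" by (simp add: y_def)
  have next_N: "nat (y + act w y - z) + 2 = N + nat (act w y)"
    using y pos_bounds(1)[where w = w and z = z and m = m] act_cases[of w y]
    by (auto simp flip: y_def)
  have G: "greedy_sum c w z (Suc m) = greedy_sum c w z m + (w (y + act w y) - c)"
    by (simp add: greedy_sum_def y_def)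
  show ?case
    unfolding P next_N G IH(2)[symmetric]
    using w01[of "y + 2"] w01[of "y + 3"] w01[of "y + 4"]
    by (elim disjE) (simp_all add: act_eq numeral_2_eq_2 numeral_3_eq_3 step IH(1) letters add.assoc)
qed

section \<open>The value as a function of \<open>p\<close>, and the Poisson equation\<close>

definition value_denom :: "real \<Rightarrow> real" where
  "value_denom p = 1 + p - 3 * p ^ 2 + 2 * p ^ 3"

definition myopic_value :: "real \<Rightarrow> real" where
  "myopic_value p = p * (3 - 3 * p + p ^ 3) / value_denom p"

text \<open>The denominator is \<open>1 + p * (1 - p) * (1 - 2 * p)\<close>, where
  \<open>p * (1 - p) \<le> 1 / 4\<close> and \<open>1 - 2 * p \<ge> -1\<close>.\<close>

lemma value_denom_pos:
  assumes "0 \<le> p" "p \<le> 1"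
  shows "0 < value_denom p"
proof -
  have "p * (1 - p) * (1 - 2 * p) \<ge> (1 / 4) * (- 1)"
  proof -
    have "0 \<le> p * (1 - p)" using assms by simp
    moreover have "p * (1 - p) \<le> 1 / 4"
      using zero_le_power2[of "p - 1 / 2"] by (simp add: power2_eq_square algebra_simps)
    moreover have "p * (1 - p) * (- 1) \<le> p * (1 - p) * (1 - 2 * p)"
      using assms by (intro mult_left_mono) auto
    ultimately show ?thesis by linarith
  qed
  moreover have "value_denom p = 1 + p * (1 - p) * (1 - 2 * p)"
    by (simp add: value_denom_def algebra_simps power2_eq_square power3_eq_cube)
  ultimately show ?thesis by simp
qed

text \<open>The factored complement gives the upper bound on the value and is the form in which the
  value enters the Poisson equation.\<close>

lemma one_minus_myopic_value:
  assumes "0 \<le> p" "p \<le> 1"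
  shows "1 - myopic_value p = (1 - p) ^ 3 * (1 + p) / value_denom p"
proof -
  have "value_denom p - p * (3 - 3 * p + p ^ 3) = (1 - p) ^ 3 * (1 + p)"
    by (simp add: value_denom_def algebra_simps power2_eq_square power3_eq_cube)
  then show ?thesis
    using value_denom_pos[OF assms] by (simp add: myopic_value_def field_simps)
qed

text \<open>These bounds make the value an admissible charge in the exchange argument.\<close>

lemma myopic_value_bounds:
  assumes "0 \<le> p" "p \<le> 1"
  shows "0 \<le> myopic_value p" "myopic_value p \<le> 1"
proof -
  have "0 \<le> 3 - 3 * p + p ^ 3" using assms by simp
  then show "0 \<le> myopic_value p"
    unfolding myopic_value_def using assms value_denom_pos[OF assms] by simp
  have "0 \<le> 1 - myopic_value p"
    unfolding one_minus_myopic_value[OF assms] using assms value_denom_pos[OF assms] by simp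
  then show "myopic_value p \<le> 1" by simp
qed

text \<open>The solution of the Poisson equation of the automaton (lemma \<open>gain_mean\<close>) normalized to
  vanish at \<open>Skip\<close>; its solvability is what determines \<open>myopic_value\<close>.\<close>
fun bias :: "real \<Rightarrow> phase \<Rightarrow> real" where
  "bias p (Seen a) = (if a then (1 - p)\<^sup>2 else - p * (1 - p)) / value_denom p"
| "bias p (Tie a) = of_bool a - myopic_value p + p * (1 - p)\<^sup>2 / value_denom p"
| "bias p s = 0"

definition gain :: "real \<Rightarrow> phase \<Rightarrow> bool \<Rightarrow> real" where
  "gain p s b = phase_reward (myopic_value p) s b + bias p (phase_step s b)"

lemma gain_mean:
  assumes "0 \<le> p" "p \<le> 1"
  shows "(1 - p) * gain p s False + p * gain p s True = bias p s"
proof -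
  define t where "t = 1 / value_denom p"
  have t: "t * (1 + p - 3 * p ^ 2 + 2 * p ^ 3) = 1"
    using value_denom_pos[OF assms] by (simp add: t_def flip: value_denom_def)
  have v: "myopic_value p = 1 - (1 - p) ^ 3 * (1 + p) * t"
    using one_minus_myopic_value[OF assms] by (simp add: t_def)
  have div: "x / value_denom p = x * t" for x by (simp add: t_def)
  show ?thesis
  proof (cases s)
    case (Seen a)
    \<comment> \<open>The large bracket equals \<open>(1 - p) * value_denom p\<close>. The equation
      at \<open>Seen False\<close> reduces to this identity.\<close>
    have "(p - 1) + t * ((1 - p) ^ 3 * (1 + p) + p * (1 - p) ^ 3 + p * (1 - p)) = 0"
      using t by algebra
    then show ?thesis
      unfolding Seen
      by (cases a)
        (simp_all add: gain_def v div algebra_simps power2_eq_square power3_eq_cube)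
  next
    case (Tie a)
    show ?thesis
      unfolding Tie by (simp add: gain_def v div algebra_simps power2_eq_square)
  qed (simp_all add: gain_def div algebra_simps power2_eq_square)
qed

text \<open>A function of one bit is its mean plus its slope times the centred bit, and the mean is
  \<open>bias p s\<close> by the Poisson equation.\<close>

lemma gain_decomp:
  assumes "0 \<le> p" "p \<le> 1"
  shows "gain p s b - bias p s = (gain p s True - gain p s False) * (of_bool b - p)"
  using gain_mean[OF assms, of s] by (cases b) (simp_all add: algebra_simps)

lemma phase_UNIV: "UNIV = {Boundary, Skip, Seen True, Seen False, Tie True, Tie False}"
proof (intro set_eqI iffI)
  show "s \<in> {Boundary, Skip, Seen True, Seen False, Tie True, Tie False}" for s
    by (cases s) auto
qed simp

lemma phase_fun_bounded:
  fixes f :: "phase \<Rightarrow> real"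
  shows "\<exists>B. \<forall>s. \<bar>f s\<bar> \<le> B"
proof (intro exI allI)
  fix s
  have "finite (UNIV :: phase set)" unfolding phase_UNIV by simp
  then show "\<bar>f s\<bar> \<le> Max (range (\<lambda>s. \<bar>f s\<bar>))" by (intro Max_ge) auto
qed

text \<open>The decompositions of the single steps telescope along the run. The coefficient at
  \<open>i\<close> depends on \<open>run x i\<close>, hence only on letters before \<open>i\<close>,
  so the right-hand side is a martingale transform.\<close>

lemma run_reward_martingale:
  assumes "0 \<le> p" "p \<le> 1"
  shows "run_reward (myopic_value p) x n + bias p (run x n)
    = (\<Sum>i<n. (gain p (run x i) True - gain p (run x i) False) * (of_bool (x i) - p))"
proof (induction n)
  case (Suc n)
  have "run_reward (myopic_value p) x (Suc n) + bias p (run x (Suc n))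
      = run_reward (myopic_value p) x n + bias p (run x n) + (gain p (run x n) (x n) - bias p (run x n))"
    by (simp add: run_reward_def gain_def)
  also have "\<dots> = (\<Sum>i<Suc n. (gain p (run x i) True - gain p (run x i) False) * (of_bool (x i) - p))"
    unfolding gain_decomp[OF assms] Suc by simp
  finally show ?case .
qed (simp add: run_reward_def)

lemma (in prob_space) run_reward_slln:
  fixes X :: "nat \<Rightarrow> 'a \<Rightarrow> bool"
  assumes p: "0 \<le> p" "p \<le> 1"
    and indep: "indep_vars (\<lambda>_. count_space UNIV) X UNIV"
    and mean: "\<And>n. expectation (\<lambda>\<omega>. of_bool (X n \<omega>)) = p"
  shows "AE \<omega> in M. (\<lambda>n. run_reward (myopic_value p) (\<lambda>k. X k \<omega>) n / real n) \<longlonglongrightarrow> 0"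
proof -
  define \<psi> where "\<psi> s = gain p s True - gain p s False" for s
  obtain B where B: "\<And>s. \<bar>\<psi> s\<bar> \<le> B" using phase_fun_bounded[of \<psi>] by blast
  obtain C where C: "\<And>s. \<bar>bias p s\<bar> \<le> C" using phase_fun_bounded[of "bias p"] by blast
  have "AE \<omega> in M. (\<lambda>n. (\<Sum>i<n. \<psi> (run (\<lambda>k. X k \<omega>) i) * (of_bool (X i \<omega>) - p)) / real n) \<longlonglongrightarrow> 0"
  proof (rule predictable_bernoulli_slln[OF indep mean, where \<psi> = "\<lambda>n x. \<psi> (run x n)" and B = B])
    show "\<psi> (run x n) = \<psi> (run y n)" if "\<And>i. i < n \<Longrightarrow> x i = y i" for n x y
      using run_cong[of n x y] that by simp
    show "\<bar>\<psi> (run x n)\<bar> \<le> B" for n x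
      by (rule B)
  qed
  then show ?thesis
  proof (rule AE_mp, intro AE_I2 impI)
    fix \<omega>
    define x where "x = (\<lambda>k. X k \<omega>)"
    assume "(\<lambda>n. (\<Sum>i<n. \<psi> (run (\<lambda>k. X k \<omega>) i) * (of_bool (X i \<omega>) - p)) / real n) \<longlonglongrightarrow> 0"
    then have "(\<lambda>n. (run_reward (myopic_value p) x n + bias p (run x n)) / real n) \<longlonglongrightarrow> 0"
      by (simp add: run_reward_martingale[OF p] \<psi>_def x_def)
    moreover have "(\<lambda>n. bias p (run x n) / real n) \<longlonglongrightarrow> 0"
    proof (rule tendsto_rabs_zero_cancel, rule tendsto_sandwich[OF _ _ tendsto_const])
      show "(\<lambda>n. C / real n) \<longlonglongrightarrow> 0" by (rule lim_const_over_n)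
      show "\<forall>\<^sub>F n in sequentially. \<bar>bias p (run x n) / real n\<bar> \<le> C / real n"
        using C by (intro always_eventually) (simp add: divide_right_mono)
    qed simp
    ultimately have "(\<lambda>n. (run_reward (myopic_value p) x n + bias p (run x n)) / real n
        - bias p (run x n) / real n) \<longlonglongrightarrow> 0 - 0"
      by (rule tendsto_diff)
    then show "(\<lambda>n. run_reward (myopic_value p) (\<lambda>k. X k \<omega>) n / real n) \<longlonglongrightarrow> 0"
      by (simp add: x_def add_divide_distrib)
  qed
qed

text \<open>This is a change of clock from letters to stages: \<open>m\<close> stages use between
  \<open>2 * m\<close> and \<open>3 * m + 2\<close> letters, so sublinearity in one clock gives
  sublinearity in the other.\<close>

lemma greedy_sum_sublinear:
  assumes w: "binary w"
    and lim: "(\<lambda>n. run_reward c (\<lambda>i. w (z + 1 + int i) = 1) n / real n) \<longlonglongrightarrow> 0"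
  shows "(\<lambda>m. greedy_sum c w z m / real m) \<longlonglongrightarrow> 0"
proof -
  let ?R = "run_reward c (\<lambda>i. w (z + 1 + int i) = 1)"
  define N where "N m = nat (pos w z m - z) + 2" for m
  have N: "2 * m \<le> N m" "N m \<le> 3 * m + 2" for m
    using pos_bounds[where w = w and z = z and m = m] by (auto simp: N_def)
  have "filterlim N at_top sequentially"
    using N(1) by (intro filterlim_at_top_mono[OF filterlim_ident] always_eventually)
      (metis mult_2 le_add1 order_trans)
  then have "(\<lambda>m. ?R (N m) / real (N m)) \<longlonglongrightarrow> 0"
    by (rule filterlim_compose[OF lim])
  then have five: "(\<lambda>m. 5 * \<bar>?R (N m) / real (N m)\<bar>) \<longlonglongrightarrow> 0"
    by (intro tendsto_mult_right_zero tendsto_rabs_zero)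
  have le: "\<forall>\<^sub>F m in sequentially. \<bar>greedy_sum c w z m / real m\<bar> \<le> 5 * \<bar>?R (N m) / real (N m)\<bar>"
  proof (rule eventually_sequentiallyI)
    fix m :: nat assume m: "1 \<le> m"
    have R: "greedy_sum c w z m = ?R (N m)"
      using run_greedy[OF w] by (simp add: N_def)
    \<comment> \<open>For \<open>m \<ge> 1\<close>, \<open>3 * m + 2\<close> is at most
      \<open>5 * m\<close>; this is the source of the factor 5.\<close>
    have "real (N m) \<le> 5 * real m" using N(2)[of m] m by linarith
    moreover have N_pos: "0 < N m" by (simp add: N_def)
    ultimately have "\<bar>?R (N m)\<bar> * real (N m) \<le> \<bar>?R (N m)\<bar> * (5 * real m)"
      by (intro mult_left_mono) auto
    then show "\<bar>greedy_sum c w z m / real m\<bar> \<le> 5 * \<bar>?R (N m) / real (N m)\<bar>"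
      using m N_pos by (simp add: R field_simps)
  qed
  have "(\<lambda>m. \<bar>greedy_sum c w z m / real m\<bar>) \<longlonglongrightarrow> 0"
  proof (rule tendsto_sandwich[OF _ le tendsto_const five])
    show "\<forall>\<^sub>F m in sequentially. 0 \<le> \<bar>greedy_sum c w z m / real m\<bar>" by simp
  qed
  then show ?thesis by (rule tendsto_rabs_zero_cancel)
qed

section \<open>Payoffs of strategies\<close>

lemma myopic_strategy_eq:
  "myopic_strategy g 4 sigma_star m \<omega> z = act (\<lambda>y. g y \<omega>) (pos (\<lambda>y. g y \<omega>) z m)"
proof -
  have upt: "[1..<Suc 4] = [1, 2, 3, 4]" by (simp add: upt_rec)
  let ?s = "\<lambda>\<omega> y. sigma_star (map (\<lambda>j. g (y + int j) \<omega>) [1..<Suc 4])"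
  have s: "?s \<omega> y = act (\<lambda>y. g y \<omega>) y" for y
    unfolding upt act_def by simp
  have "stationary_state ?s \<omega> z m = pos (\<lambda>y. g y \<omega>) z m" for m
    by (induction m) (simp_all only: stationary_state.simps pos.simps s)
  then show ?thesis
    unfolding myopic_strategy_def stationary_strategy_def s by simp
qed

lemma state_myopic_strategy:
  "state (myopic_strategy g 4 sigma_star) z \<omega> m = pos (\<lambda>y. g y \<omega>) z m"
  by (induction m) (simp_all add: myopic_strategy_eq)

lemma mean_payoff_myopic_strategy:
  assumes "0 < n"
  shows "mean_payoff g n z (myopic_strategy g 4 sigma_star) \<omega>
    = c + greedy_sum c (\<lambda>y. g y \<omega>) z n / real n"
  using assms
  by (simp add: mean_payoff_def greedy_sum_def state_myopic_strategy myopic_strategy_eq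
      sum_subtractf field_simps)

section \<open>Measurability of the myopic strategy\<close>

lemma space_payoff_algebra: "space (payoff_algebra M g) = space M"
  unfolding payoff_algebra_def by (rule space_measure_of) auto

lemma payoff_algebra_measurable [measurable]: "g y \<in> borel_measurable (payoff_algebra M g)"
proof (rule measurableI)
  fix A :: "real set" assume "A \<in> sets borel"
  then show "g y -` A \<inter> space (payoff_algebra M g) \<in> sets (payoff_algebra M g)"
    unfolding space_payoff_algebra unfolding payoff_algebra_def
    by (subst sets_measure_of) (auto intro!: sigma_sets.Basic)
qed simp

lemma act_measurable [measurable]:
  "(\<lambda>\<omega>. act (\<lambda>y. g y \<omega>) y) \<in> measurable (payoff_algebra M g) (count_space UNIV)"
  unfolding act_eq by measurable

lemma pos_measurable [measurable]:
  "(\<lambda>\<omega>. pos (\<lambda>y. g y \<omega>) z m) \<in> measurable (payoff_algebra M g) (count_space UNIV)"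
proof (induction m)
  case (Suc m)
  note [measurable] = Suc measurable_compose_countable[OF act_measurable Suc]
  show ?case unfolding pos.simps by measurable
qed simp

text \<open>Initial and current states range over a countable set, so measurability can be checked
  with each of them fixed. The target shrinks to \<open>{2, 3}\<close> because \<open>act\<close>
  takes no other value.\<close>

lemma myopic_strategy_in_strategies: "myopic_strategy g 4 sigma_star \<in> strategies M g {2, 3}"
proof -
  have "case_prod (myopic_strategy g 4 sigma_star m)
      \<in> payoff_algebra M g \<Otimes>\<^sub>M count_space UNIV \<rightarrow>\<^sub>M count_space {2, 3}" for m
  proof -
    let ?P = "payoff_algebra M g"
    have act: "(\<lambda>\<omega>. act (\<lambda>y. g y \<omega>) (pos (\<lambda>y. g y \<omega>) z m)) \<in> ?P \<rightarrow>\<^sub>M count_space UNIV" for z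
      by (rule measurable_compose_countable[OF act_measurable pos_measurable])
    have "(\<lambda>x. act (\<lambda>y. g y (fst x)) (pos (\<lambda>y. g y (fst x)) (snd x) m))
        \<in> ?P \<Otimes>\<^sub>M count_space UNIV \<rightarrow>\<^sub>M count_space UNIV"
      by (rule measurable_compose_countable[where g = snd and
            f = "\<lambda>z x. act (\<lambda>y. g y (fst x)) (pos (\<lambda>y. g y (fst x)) z m)"])
        (auto intro: measurable_compose[OF measurable_fst act])
    then have "(\<lambda>x. act (\<lambda>y. g y (fst x)) (pos (\<lambda>y. g y (fst x)) (snd x) m))
        \<in> ?P \<Otimes>\<^sub>M count_space UNIV \<rightarrow>\<^sub>M restrict_space (count_space UNIV) {2, 3}"
      using act_cases by (intro measurable_restrict_space2) auto
    then show ?thesis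
      by (simp add: myopic_strategy_eq case_prod_unfold restrict_count_space)
  qed
  then show ?thesis by (simp add: strategies_def)
qed

section \<open>Upper bound over all strategies\<close>

lemma mean_payoff_eq_path_sum:
  "real n * (mean_payoff g n z \<sigma> \<omega> - c)
    = path_sum c (\<lambda>y. g y \<omega>) z (map (\<lambda>m. \<sigma> m \<omega> z) [0..<n])"
proof -
  have state: "state \<sigma> z \<omega> n = z + sum_list (map (\<lambda>m. \<sigma> m \<omega> z) [0..<n])" for n
    by (induction n) simp_all
  have "(\<Sum>m<n. g (state \<sigma> z \<omega> m + \<sigma> m \<omega> z) \<omega> - c)
      = path_sum c (\<lambda>y. g y \<omega>) z (map (\<lambda>m. \<sigma> m \<omega> z) [0..<n])"
    by (induction n) (simp_all add: path_sum_append state)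
  moreover have "real n * (mean_payoff g n z \<sigma> \<omega> - c)
      = (\<Sum>m<n. g (state \<sigma> z \<omega> m + \<sigma> m \<omega> z) \<omega> - c)"
    by (cases "n = 0") (simp_all add: mean_payoff_def sum_subtractf field_simps)
  ultimately show ?thesis by simp
qed

text \<open>The threshold for \<open>n\<close> is uniform in the strategy, as required for a bound
  on the maximum defining \<open>stage_value\<close>.\<close>

lemma mean_payoff_upper_bound:
  assumes w: "binary (\<lambda>y. g y \<omega>)" and c: "0 \<le> c" "c \<le> 1" and \<omega>: "\<omega> \<in> space M"
    and lim: "(\<lambda>m. greedy_sum c (\<lambda>y. g y \<omega>) z m / real m) \<longlonglongrightarrow> 0" and e: "0 < e"
  shows "\<forall>\<^sub>F n in sequentially. \<forall>\<sigma> \<in> strategies M g {2, 3}. mean_payoff g n z \<sigma> \<omega> < c + e"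
proof -
  let ?G = "greedy_sum c (\<lambda>y. g y \<omega>) z"
  \<comment> \<open>The dominating greedy path has at most \<open>3 * n\<close> stages, so a rate of
    \<open>e / 6\<close> costs \<open>e / 2\<close> per stage played. The other half of
    \<open>e\<close> absorbs the constant \<open>C + 2\<close>.\<close>
  have "\<forall>\<^sub>F m in sequentially. ?G m / real m < e / 6"
    by (rule order_tendstoD(2)[OF lim]) (use e in simp)
  then obtain m0 where m0: "\<And>m. m0 \<le> m \<Longrightarrow> ?G m / real m < e / 6"
    by (auto simp: eventually_sequentially)
  \<comment> \<open>\<open>C\<close> covers the finitely many \<open>m\<close> for which the
    sublinear bound may still fail.\<close>
  define C where "C = (\<Sum>m\<le>m0. \<bar>?G m\<bar>)"
  have G: "?G m \<le> C + e / 6 * real m" for m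
  proof (cases "m \<le> m0")
    case True
    have "\<bar>?G m\<bar> \<le> C" unfolding C_def using True by (intro member_le_sum) auto
    moreover have "0 \<le> e / 6 * real m" using e by simp
    ultimately show ?thesis by linarith
  next
    case False
    then have "?G m \<le> e / 6 * real m" using m0[of m] by (simp add: field_simps)
    moreover have "0 \<le> C" unfolding C_def by (intro sum_nonneg) auto
    ultimately show ?thesis by linarith
  qed
  have "(\<lambda>n. (C + 2) / real n) \<longlonglongrightarrow> 0" by (rule lim_const_over_n)
  then have "\<forall>\<^sub>F n in sequentially. (C + 2) / real n < e / 2"
    using order_tendstoD(2) e by (metis half_gt_zero)
  then show ?thesis
    using eventually_gt_at_top[of 0]
  proof (eventually_elim, intro ballI)
    fix n \<sigma> assume n: "(C + 2) / real n < e / 2" "0 < n" and \<sigma>: "\<sigma> \<in> strategies M g {2, 3}"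
    define as where "as = map (\<lambda>m. \<sigma> m \<omega> z) [0..<n]"
    have \<sigma>23: "\<sigma> m \<omega> z \<in> {2, 3}" for m using strategy_action[OF \<sigma> \<omega>] .
    then have "set as \<subseteq> {2, 3}" by (auto simp: as_def)
    from path_sum_le_greedy_sum[OF w c this, of z] obtain m where
      m: "int m \<le> sum_list as" "path_sum c (\<lambda>y. g y \<omega>) z as \<le> ?G m + 2" by blast
    have "\<sigma> m \<omega> z \<le> 3" for m using \<sigma>23[of m] by auto
    then have "sum_list as \<le> sum_list (map (\<lambda>_. 3) [0..<n])"
      unfolding as_def by (intro sum_list_mono) auto
    also have "\<dots> = 3 * int n" by (simp add: sum_list_triv)
    finally have "real m \<le> 3 * real n" using m(1) by linarith
    then have "e / 6 * real m \<le> e / 6 * (3 * real n)"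
      using e by (intro mult_left_mono) auto
    then have "real n * (mean_payoff g n z \<sigma> \<omega> - c) \<le> C + 2 + e / 2 * real n"
      using m(2) G[of m] unfolding mean_payoff_eq_path_sum as_def[symmetric] by simp
    also have "\<dots> < real n * e"
      using n by (simp add: field_simps)
    finally show "mean_payoff g n z \<sigma> \<omega> < c + e" using n(2) by simp
  qed
qed

text \<open>Binary values and the mean transfer through the common law; binarity holds at all
  vertices at once because there are countably many. Independence survives the reindexing because
  distinct \<open>i\<close> give disjoint singleton blocks of vertices.\<close>

lemma iid_bernoulli_letters:
  assumes "prob_space M" "0 \<le> p" "p \<le> 1" and iid: "iid_bernoulli M p g"
  shows "AE \<omega> in M. binary (\<lambda>y. g y \<omega>)"
    and "prob_space.indep_vars M (\<lambda>_. count_space UNIV) (\<lambda>i \<omega>. g (z + 1 + int i) \<omega> = 1) UNIV"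
    and "prob_space.expectation M (\<lambda>\<omega>. of_bool (g y \<omega> = 1)) = p"
proof -
  interpret prob_space M by fact
  have indep: "indep_vars (\<lambda>_. borel) g UNIV"
    and distr: "distr M borel (g y) = distr (measure_pmf (bernoulli_pmf p)) borel of_bool" for y
    using iid by (auto simp: iid_bernoulli_def)
  have g_meas [measurable]: "g y \<in> borel_measurable M" for y
    using indep by (auto simp: indep_vars_def)
  have "AE x in distr M borel (g y). x = 0 \<or> x = 1" for y
    unfolding distr by (subst AE_distr_iff) (auto simp: of_bool_def)
  then have "AE \<omega> in M. g y \<omega> = 0 \<or> g y \<omega> = 1" for y
    by (subst (asm) AE_distr_iff) auto
  then show "AE \<omega> in M. binary (\<lambda>y. g y \<omega>)"
    unfolding binary_def by (simp add: AE_all_countable)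
  have "indep_vars (\<lambda>i. PiM {z + 1 + int i} (\<lambda>_. borel))
      (\<lambda>i \<omega>. restrict (\<lambda>y. g y \<omega>) {z + 1 + int i}) UNIV"
    by (rule indep_vars_restrict[OF indep]) (auto simp: disjoint_family_on_def)
  moreover have "(\<lambda>x. x y = (1 :: real)) \<in> PiM {y} (\<lambda>_. borel) \<rightarrow>\<^sub>M count_space UNIV" for y :: int
  proof -
    have [measurable]: "(\<lambda>x. x y) \<in> PiM {y} (\<lambda>_. borel :: real measure) \<rightarrow>\<^sub>M borel"
      by (rule measurable_component_singleton) simp
    show ?thesis by measurable
  qed
  ultimately have "indep_vars (\<lambda>_. count_space UNIV)
      (\<lambda>i \<omega>. restrict (\<lambda>y. g y \<omega>) {z + 1 + int i} (z + 1 + int i) = 1) UNIV"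
    by (rule indep_vars_compose2[where Y = "\<lambda>i x. x (z + 1 + int i) = 1"])
  then show "indep_vars (\<lambda>_. count_space UNIV) (\<lambda>i \<omega>. g (z + 1 + int i) \<omega> = 1) UNIV"
    by simp
  have "expectation (\<lambda>\<omega>. of_bool (g y \<omega> = 1) :: real) = (\<integral>x. (of_bool (x = 1) :: real) \<partial>distr M borel (g y))"
    by (subst integral_distr) auto
  also have "\<dots> = (\<integral>b. of_bool (of_bool b = (1 :: real)) \<partial>measure_pmf (bernoulli_pmf p))"
    unfolding distr by (subst integral_distr) auto
  also have "\<dots> = p" using assms by simp
  finally show "expectation (\<lambda>\<omega>. of_bool (g y \<omega> = 1)) = p" .
qed

theorem proposition4p4:
  fixes M :: "'w measure" and g :: "int \<Rightarrow> 'w \<Rightarrow> real" and p :: real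
  assumes "prob_space M"
    and "0 \<le> p" and "p \<le> 1"
    and "iid_bernoulli M p g"
  shows "optimal M g {2, 3} (myopic_strategy g 4 sigma_star) \<and>
         has_limit_value M g {2, 3}
           (p * (3 - 3 * p + p ^ 3) / (1 + p - 3 * p ^ 2 + 2 * p ^ 3))"
proof -
  interpret prob_space M by fact
  let ?v = "myopic_value p" and ?\<sigma> = "myopic_strategy g 4 sigma_star"
  note letters = iid_bernoulli_letters[OF assms]
  \<comment> \<open>On this event the argument is deterministic. It depends on \<open>z\<close>
    because the automaton starts reading at \<open>z + 1\<close>.\<close>
  have good: "AE \<omega> in M. binary (\<lambda>y. g y \<omega>) \<and>
    (\<lambda>m. greedy_sum ?v (\<lambda>y. g y \<omega>) z m / real m) \<longlonglongrightarrow> 0" for z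
    using letters(1) run_reward_slln[OF assms(2,3) letters(2) letters(3), of z]
    by eventually_elim (auto intro: greedy_sum_sublinear)
  have payoff: "(\<lambda>n. mean_payoff g n z ?\<sigma> \<omega>) \<longlonglongrightarrow> ?v"
    if "(\<lambda>m. greedy_sum ?v (\<lambda>y. g y \<omega>) z m / real m) \<longlonglongrightarrow> 0" for z \<omega>
  proof (rule Lim_transform_eventually)
    show "(\<lambda>n. ?v + greedy_sum ?v (\<lambda>y. g y \<omega>) z n / real n) \<longlonglongrightarrow> ?v"
      using tendsto_add[OF tendsto_const that] by simp
    show "\<forall>\<^sub>F n in sequentially. ?v + greedy_sum ?v (\<lambda>y. g y \<omega>) z n / real n = mean_payoff g n z ?\<sigma> \<omega>"
      using eventually_gt_at_top[of 0]
      by eventually_elim (rule mean_payoff_myopic_strategy[symmetric])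
  qed
  have "AE \<omega> in M. (\<lambda>n. stage_value M g {2, 3} n z \<omega>) \<longlonglongrightarrow> ?v" for z
    using good[of z]
  proof (rule AE_mp, intro AE_I2 impI)
    fix \<omega> assume \<omega>: "\<omega> \<in> space M"
      and *: "binary (\<lambda>y. g y \<omega>) \<and> (\<lambda>m. greedy_sum ?v (\<lambda>y. g y \<omega>) z m / real m) \<longlonglongrightarrow> 0"
    have fin: "finite ((\<lambda>\<sigma>. mean_payoff g n z \<sigma> \<omega>) ` strategies M g {2, 3})" for n
      by (rule finite_mean_payoffs) (use \<omega> in auto)
    show "(\<lambda>n. stage_value M g {2, 3} n z \<omega>) \<longlonglongrightarrow> ?v"
    proof (rule order_tendstoI)
      fix a assume "a < ?v"
      then have "\<forall>\<^sub>F n in sequentially. a < mean_payoff g n z ?\<sigma> \<omega>"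
        using order_tendstoD(1)[OF payoff] * by blast
      then show "\<forall>\<^sub>F n in sequentially. a < stage_value M g {2, 3} n z \<omega>"
      proof eventually_elim
        case (elim n)
        have "mean_payoff g n z ?\<sigma> \<omega> \<le> stage_value M g {2, 3} n z \<omega>"
          unfolding stage_value_def using myopic_strategy_in_strategies fin by (intro Max_ge) auto
        with elim show ?case by simp
      qed
    next
      fix a assume "?v < a"
      \<comment> \<open>The right-hand side is \<open>a\<close>, written as charge plus margin to
        match the uniform bound.\<close>
      then have "\<forall>\<^sub>F n in sequentially. \<forall>\<sigma> \<in> strategies M g {2, 3}. mean_payoff g n z \<sigma> \<omega> < ?v + (a - ?v)"
        using * myopic_value_bounds[OF assms(2,3)] \<omega> by (intro mean_payoff_upper_bound) auto
      then show "\<forall>\<^sub>F n in sequentially. stage_value M g {2, 3} n z \<omega> < a"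
        unfolding stage_value_def using fin strategies_nonempty[of "{2, 3}" M g]
        by (simp add: Max_less_iff)
    qed
  qed
  then have lim: "has_limit_value M g {2, 3} ?v" by (simp add: has_limit_value_def)
  moreover have "AE \<omega> in M. (\<lambda>n. mean_payoff g n z ?\<sigma> \<omega>) \<longlonglongrightarrow> ?v" for z
    using good[of z] by eventually_elim (use payoff in blast)
  ultimately have "optimal M g {2, 3} ?\<sigma>"
    unfolding optimal_def using myopic_strategy_in_strategies by blast
  with lim show ?thesis
    by (simp add: myopic_value_def value_denom_def)
qed

end
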